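(* Let $D\in\mathbb{R}^{n\times k}$ and let $m\ge1$ be an integer. (a) For $P\in\mathbb{R}^{n\times k}$, $$\mathrm{tr}\Big(P^{\mathrm T}\frac{\partial\,\mathrm{tr}((P^{\mathrm T}D)^m)}{\partial P}\Big)=m\,\mathrm{tr}((P^{\mathrm T}D)^m).$$ (b) Let $P,\widehat P\in\mathbb{R}^{n\times k}$. (i) For $m=1$, $\mathrm{tr}\big(\widehat P^{\mathrm T}\frac{\partial\,\mathrm{tr}(P^{\mathrm T}D)}{\partial P}\big)=\mathrm{tr}(\widehat P^{\mathrm T}D)$. (ii) For $m\ge1$, if $P^{\mathrm T}D\succeq0$, then $$\mathrm{tr}\Big(\widehat P^{\mathrm T}\frac{\partial\,\mathrm{tr}((P^{\mathrm T}D)^m)}{\partial P}\Big)\le\mathrm{tr}((\widetilde P^{\mathrm T}D)^m)+(m-1)\,\mathrm{tr}((P^{\mathrm T}D)^m),$$ where $\widetilde P=\widehat PQ$ for $Q\in\mathrm{St}(k,k)$ such that $\widetilde P^{\mathrm T}D\succeq0$. In particular, $f(P)=\mathrm{tr}((P^{\mathrm T}D)^m)$ satisfies conditions (1) and (2) of the definition of an atomic function for NPDo with $\mathbb{P}=\mathrm{St}(k,n)_{D+}$, $\alpha=1$ and $\beta=m-1$, and thus is an atomic function for NPDo. Just for the case $m=1$, one can also take $\mathbb{P}=\mathrm{St}(k,n)$ and $\widetilde P=\widehat P$ (i.e. $Q=I_k$) in (1) and (2), and then (2) becomes an equality; therefore $\mathrm{tr}(P^{\mathrm T}D)$ is also an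 atomic function for NPDo with $\mathbb{P}=\mathrm{St}(k,n)$ and $Q=I_k$.
   Context: $1\le k\le n$; $\mathrm{St}(k,n)=\{P\in\mathbb{R}^{n\times k}: P^{\mathrm T}P=I_k\}$; $\mathrm{St}(k,n)_{D+}=\{X\in\mathrm{St}(k,n): X^{\mathrm T}D\succeq0\}$; $A\succeq0$ means symmetric positive semidefinite; $\partial f(P)/\partial P$ is the $n\times k$ matrix of partial derivatives with all entries of $P$ treated as independent. Atomic function for NPDo: a differentiable real function $f$ on a neighborhood $\{P\in\mathbb{R}^{n\times k}:\|P^{\mathrm T}P-I_k\|<\delta\}$ of $\mathrm{St}(k,n)$ for which there are a subset $\mathbb{P}\subseteq\mathrm{St}(k,n)$ and constants $\alpha>0$, $\beta\ge 0$, $\gamma=\alpha+\beta$ such that (1) $\mathrm{tr}\big(P^{\mathrm T}\frac{\partial f(P)}{\partial P}\big)=\gamma f(P)$ for all $P\in\mathbb{P}$; and (2) given $P\in\mathbb{P}$ and $\widehat P\in\mathrm{St}(k,n)$, there exists $Q\in\mathrm{St}(k,k)$ such that $\widetilde P=\widehat PQ\in\mathbb{P}$ and $\mathrm{tr}\big(\widehat P^{\mathrm T}\frac{\partial f(P)}{\partial P}\big)\le\alpha f(\widetilde P)+\beta f(P)$. *)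

theory Defs
  imports "HOL-Analysis.Analysis"
begin

text \<open>Real n-by-k matrices are elements of \<open>real ^ 'k ^ 'n\<close>, so that \<open>P $ i $ j\<close> is the entry in
  row \<open>i\<close> and column \<open>j\<close>. On this type the overloaded operations \<open>*\<close> and \<open>^\<close> act entrywise;
  the matrix product is \<open>**\<close>, and matrix powers are defined here.\<close>

primrec matrix_pow :: "real ^ 'k ^ 'k \<Rightarrow> nat \<Rightarrow> real ^ 'k ^ 'k" where
  "matrix_pow A 0 = mat 1"
| "matrix_pow A (Suc m) = A ** matrix_pow A m"

definition psd :: "real ^ 'k ^ 'k \<Rightarrow> bool" where
  "psd A \<longleftrightarrow> transpose A = A \<and> (\<forall>x. 0 \<le> x \<bullet> (A *v x))"

definition stiefel :: "(real ^ 'k ^ 'n) set" where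
  "stiefel = {P. transpose P ** P = mat 1}"

definition stiefel_Dplus :: "real ^ 'k ^ 'n \<Rightarrow> (real ^ 'k ^ 'n) set" where
  "stiefel_Dplus D = {X \<in> stiefel. psd (transpose X ** D)}"

text \<open>Here \<open>axis i (axis j 1)\<close> is the matrix unit with entry 1 in position \<open>(i, j)\<close>, so the
  \<open>(i, j)\<close> entry below is the partial derivative of \<open>f\<close> in the \<open>(i, j)\<close> entry of its argument.\<close>

definition matrix_grad :: "(real ^ 'k ^ 'n \<Rightarrow> real) \<Rightarrow> real ^ 'k ^ 'n \<Rightarrow> real ^ 'k ^ 'n" where
  "matrix_grad f P = (\<chi> i j. deriv (\<lambda>t. f (P + t *\<^sub>R axis i (axis j 1))) 0)"

text \<open>The norm on matrices is the library's Euclidean (Frobenius) norm. As \<open>\<delta>\<close> is existentially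
  quantified and all norms on a finite-dimensional space are equivalent, its choice is immaterial.\<close>

definition differentiable_near_stiefel :: "(real ^ 'k ^ 'n \<Rightarrow> real) \<Rightarrow> bool" where
  "differentiable_near_stiefel f \<longleftrightarrow>
    (\<exists>\<delta>>0. \<forall>P. norm (transpose P ** P - mat 1) < \<delta> \<longrightarrow> f differentiable (at P))"

definition atomic_cond1 ::
    "(real ^ 'k ^ 'n \<Rightarrow> real) \<Rightarrow> (real ^ 'k ^ 'n) set \<Rightarrow> real \<Rightarrow> bool" where
  "atomic_cond1 f PP \<gamma> \<longleftrightarrow> (\<forall>P\<in>PP. trace (transpose P ** matrix_grad f P) = \<gamma> * f P)"

definition atomic_cond2 ::
    "(real ^ 'k ^ 'n \<Rightarrow> real) \<Rightarrow> (real ^ 'k ^ 'n) set \<Rightarrow> real \<Rightarrow> real \<Rightarrow> bool" where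
  "atomic_cond2 f PP \<alpha> \<beta> \<longleftrightarrow>
    (\<forall>P\<in>PP. \<forall>P'\<in>stiefel. \<exists>Q\<in>(stiefel :: (real ^ 'k ^ 'k) set).
       P' ** Q \<in> PP \<and>
       trace (transpose P' ** matrix_grad f P) \<le> \<alpha> * f (P' ** Q) + \<beta> * f P)"

definition atomic_NPDo_with ::
    "(real ^ 'k ^ 'n \<Rightarrow> real) \<Rightarrow> (real ^ 'k ^ 'n) set \<Rightarrow> real \<Rightarrow> real \<Rightarrow> bool" where
  "atomic_NPDo_with f PP \<alpha> \<beta> \<longleftrightarrow>
    differentiable_near_stiefel f \<and> PP \<subseteq> stiefel \<and> 0 < \<alpha> \<and> 0 \<le> \<beta> \<and>
    atomic_cond1 f PP (\<alpha> + \<beta>) \<and> atomic_cond2 f PP \<alpha> \<beta>"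

definition atomic_NPDo :: "(real ^ 'k ^ 'n \<Rightarrow> real) \<Rightarrow> bool" where
  "atomic_NPDo f \<longleftrightarrow> (\<exists>PP \<alpha> \<beta>. atomic_NPDo_with f PP \<alpha> \<beta>)"

end

theory Submission
  imports Defs
begin

text \<open>The derivative of \<open>X \<mapsto> tr((X\<^sup>TD)\<^sup>m)\<close> in direction \<open>H\<close> is \<open>m tr((X\<^sup>TD)\<^sup>m\<^sup>-\<^sup>1H\<^sup>TD)\<close>, which settles the
  identities. For the inequality put \<open>A = P\<^sup>TD\<close> and \<open>S = Q\<^sup>TP'\<^sup>TD\<close>; it becomes
  \<open>m tr(A\<^sup>m\<^sup>-\<^sup>1QS) \<le> tr(S\<^sup>m) + (m-1) tr(A\<^sup>m)\<close>. In eigenbases of \<open>A\<close> and \<open>S\<close> the left side is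
  \<open>m \<Sum> a\<^sub>i\<^sup>m\<^sup>-\<^sup>1s\<^sub>jW\<^sub>i\<^sub>jZ\<^sub>i\<^sub>j\<close> with orthogonal \<open>W\<close> and \<open>Z\<close>; bounding \<open>W\<^sub>i\<^sub>jZ\<^sub>i\<^sub>j\<close> by the mean of the squares, which is
  doubly stochastic, reduces the claim to \<open>m a\<^sup>m\<^sup>-\<^sup>1s \<le> s\<^sup>m + (m-1)a\<^sup>m\<close> for numbers. Polar and
  spectral decompositions are both obtained by maximising over the compact orthogonal group: if
  \<open>tr(R\<^sup>TG)\<close> is maximal at \<open>R = I\<close>, then \<open>G\<close> is positive semidefinite.\<close>

section \<open>Frobenius inner product and bilinearity of the matrix product\<close>

lemma trace_transpose_mult:
  fixes A B :: "real ^ 'k ^ 'n"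
  shows "trace (transpose A ** B) = A \<bullet> B"
  unfolding trace_def matrix_matrix_mult_def transpose_def inner_vec_def
  by (simp, rule sum.swap)

lemma inner_matrix_mult_left:
  fixes A :: "real ^ 'k ^ 'n" and B :: "real ^ 'm ^ 'k" and C :: "real ^ 'm ^ 'n"
  shows "(A ** B) \<bullet> C = B \<bullet> (transpose A ** C)"
  by (simp flip: trace_transpose_mult add: matrix_transpose_mul matrix_mul_assoc)

lemma inner_matrix_mult_right:
  fixes A :: "real ^ 'k ^ 'n" and B :: "real ^ 'm ^ 'k" and C :: "real ^ 'm ^ 'n"
  shows "(A ** B) \<bullet> C = A \<bullet> (C ** transpose B)"
proof -
  have "trace (transpose B ** (transpose A ** C)) = trace (transpose A ** C ** transpose B)"
    by (rule trace_mul_sym)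
  then show ?thesis
    by (simp flip: trace_transpose_mult add: matrix_transpose_mul matrix_mul_assoc)
qed

lemma bounded_bilinear_matrix_mult:
  "bounded_bilinear (\<lambda>(A :: real ^ 'k ^ 'n) (B :: real ^ 'm ^ 'k). A ** B)"
proof -
  have "bilinear (\<lambda>(A :: real ^ 'k ^ 'n) (B :: real ^ 'm ^ 'k). A ** B)"
    unfolding bilinear_def
    by (auto intro!: linearI simp: vec_eq_iff matrix_matrix_mult_def sum.distrib
        algebra_simps sum_distrib_left)
  then show ?thesis
    by (simp add: bilinear_conv_bounded_bilinear)
qed

interpretation matrix_mult: bounded_bilinear "\<lambda>(A :: real ^ 'k ^ 'n) (B :: real ^ 'm ^ 'k). A ** B"
  by (rule bounded_bilinear_matrix_mult)

lemma bounded_linear_transpose: "bounded_linear (transpose :: real ^ 'k ^ 'n \<Rightarrow> _)"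
  by (intro linear_conv_bounded_linear[THEN iffD1] linearI)
    (auto simp: vec_eq_iff transpose_def)

lemma bounded_linear_trace: "bounded_linear (trace :: real ^ 'k ^ 'k \<Rightarrow> real)"
  by (intro linear_conv_bounded_linear[THEN iffD1] linearI)
    (auto simp: trace_def sum.distrib sum_distrib_left)

subsection \<open>The orthogonal group\<close>

lemma stiefel_square_iff: "Q \<in> stiefel \<longleftrightarrow> orthogonal_matrix Q"
  by (simp add: stiefel_def orthogonal_matrix)

lemma stiefel_mult:
  assumes "P \<in> stiefel" and "Q \<in> stiefel"
  shows "P ** Q \<in> stiefel"
proof -
  have "transpose (P ** Q) ** (P ** Q) = transpose Q ** (transpose P ** P) ** Q"
    by (simp add: matrix_transpose_mul matrix_mul_assoc)
  with assms show ?thesis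
    by (simp add: stiefel_def)
qed

lemma compact_stiefel: "compact (stiefel :: (real ^ 'k ^ 'n) set)"
proof -
  have "norm P = sqrt (real CARD('k))" if "P \<in> stiefel" for P :: "real ^ 'k ^ 'n"
  proof -
    have "P \<bullet> P = real CARD('k)"
      using that by (simp flip: trace_transpose_mult add: stiefel_def trace_I)
    then show ?thesis
      by (simp add: norm_eq_sqrt_inner)
  qed
  then have "bounded (stiefel :: (real ^ 'k ^ 'n) set)"
    unfolding bounded_iff by (metis order_refl)
  moreover have "closed (stiefel :: (real ^ 'k ^ 'n) set)"
    unfolding stiefel_def
    by (intro closed_Collect_eq matrix_mult.continuous_on
        bounded_linear.continuous_on[OF bounded_linear_transpose] continuous_intros)
  ultimately show ?thesis
    by (simp add: compact_eq_bounded_closed)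
qed

definition outer :: "real ^ 'k \<Rightarrow> real ^ 'k \<Rightarrow> real ^ 'k ^ 'k" where
  "outer u v = (\<chi> i j. u $ i * v $ j)"

lemma outer_inner: "outer u v \<bullet> G = u \<bullet> (G *v v)"
  by (simp add: outer_def inner_vec_def matrix_vector_mult_def sum_distrib_left mult_ac)

lemma outer_mult: "outer u v ** outer w z = (v \<bullet> w) *\<^sub>R outer u z"
  by (simp add: outer_def inner_vec_def matrix_matrix_mult_def vec_eq_iff sum_distrib_left
      sum_distrib_right mult_ac)

lemma transpose_outer: "transpose (outer u v) = outer v u"
  by (simp add: outer_def transpose_def vec_eq_iff mult_ac)

text \<open>The Householder reflection along \<open>v\<close>; since division by zero gives 0, it is
  the identity at \<open>v = 0\<close>.\<close>

definition reflection :: "real ^ 'k \<Rightarrow> real ^ 'k ^ 'k" where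
  "reflection v = mat 1 - (2 / (v \<bullet> v)) *\<^sub>R outer v v"

lemma orthogonal_matrix_reflection:
  assumes "v \<noteq> 0"
  shows "orthogonal_matrix (reflection v)"
proof -
  let ?c = "2 / (v \<bullet> v)"
  have "transpose (reflection v) = reflection v"
    unfolding reflection_def
    by (simp add: linear_diff[OF bounded_linear.linear[OF bounded_linear_transpose]]
        transpose_scalar transpose_outer)
  moreover have "reflection v ** reflection v =
      mat 1 + (?c * (?c * (v \<bullet> v)) - 2 * ?c) *\<^sub>R outer v v"
    unfolding reflection_def
    by (simp add: matrix_mult.diff_left matrix_mult.diff_right matrix_mult.scaleR_left
        matrix_mult.scaleR_right outer_mult vec_eq_iff algebra_simps)
  moreover have "?c * (v \<bullet> v) = 2"
    using assms by simp
  ultimately show ?thesis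
    by (simp add: orthogonal_matrix)
qed

text \<open>For small \<open>t\<close> the quadratic term is negligible, so the two signs of
  \<open>t\<close> leave no room for a nonzero slope.\<close>

lemma zero_if_linear_le_quadratic:
  fixes X Y :: real
  assumes "\<And>t. t * X \<le> t\<^sup>2 * Y"
  shows "X = 0"
proof (rule ccontr)
  assume "X \<noteq> 0"
  moreover have "X \<le> Y" "- X \<le> Y"
    using assms[of 1] assms[of "-1"] by auto
  ultimately have "0 < Y" and "0 < X\<^sup>2"
    by auto
  \<comment> \<open>The choice \<open>t = X / (2 * Y)\<close> maximises
    \<open>t * X - t\<^sup>2 * Y\<close>.\<close>
  moreover have "X\<^sup>2 / (2 * Y) \<le> X\<^sup>2 / (4 * Y)"
    using assms[of "X / (2 * Y)"] \<open>0 < Y\<close> by (simp add: power2_eq_square field_simps)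
  ultimately show False
    by (simp add: field_simps)
qed

text \<open>Reflections suffice as test matrices: a single one shows that the quadratic form is
  nonnegative, and products of two with nearly parallel axes yield symmetry.\<close>

lemma psd_if_trace_maximal:
  fixes G :: "real ^ 'k ^ 'k"
  assumes max: "\<And>R. R \<in> stiefel \<Longrightarrow> R \<bullet> G \<le> mat 1 \<bullet> G"
  shows "psd G"
proof -
  define b where "b u v = u \<bullet> (G *v v)" for u v
  have b_simps: "b (u + t *\<^sub>R w) v = b u v + t * b w v" "b u (v + t *\<^sub>R w) = b u v + t * b u w"
    for u v w t
    by (simp_all add: b_def inner_add_left inner_add_right matrix_vector_right_distrib
        matrix_vector_mult_scaleR)
  have nonneg: "0 \<le> b v v" for v
  proof (cases "v = 0")
    case False
    have "reflection v \<bullet> G = mat 1 \<bullet> G - 2 / (v \<bullet> v) * b v v"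
      by (simp add: reflection_def inner_diff_left outer_inner b_def)
    with max[of "reflection v"] orthogonal_matrix_reflection[OF False]
    have "0 \<le> 2 / (v \<bullet> v) * b v v"
      by (simp add: stiefel_square_iff)
    moreover have "0 < v \<bullet> v"
      using False by simp
    ultimately show ?thesis
      by (simp add: zero_le_divide_iff zero_le_mult_iff)
  qed (simp add: b_def)
  have two: "2 * (u \<bullet> v) * b u v \<le> (v \<bullet> v) * b u u + (u \<bullet> u) * b v v" for u v
  proof (cases "u = 0 \<or> v = 0")
    case False
    then have pos: "0 < u \<bullet> u" "0 < v \<bullet> v"
      by auto
    have "(reflection u ** reflection v) \<bullet> G = mat 1 \<bullet> G - 2 / (u \<bullet> u) * b u u
        - 2 / (v \<bullet> v) * b v v + 2 / (u \<bullet> u) * (2 / (v \<bullet> v)) * (u \<bullet> v) * b u v"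
      unfolding reflection_def
      by (simp add: matrix_mult.diff_left matrix_mult.diff_right matrix_mult.scaleR_left
        matrix_mult.scaleR_right outer_mult inner_diff_left inner_add_left outer_inner b_def
        diff_divide_distrib mult_ac)
    moreover have "(reflection u ** reflection v) \<bullet> G \<le> mat 1 \<bullet> G"
      using False
      by (intro max) (simp add: stiefel_square_iff orthogonal_matrix_mul orthogonal_matrix_reflection)
    ultimately have "2 / (u \<bullet> u) * (2 / (v \<bullet> v)) * (u \<bullet> v) * b u v
        \<le> 2 / (u \<bullet> u) * b u u + 2 / (v \<bullet> v) * b v v"
      by linarith
    with pos show ?thesis
      by (simp add: field_simps)
  qed (auto simp: b_def)
  have sym: "b w v = b v w" for v w
  proof (cases "v = 0")
    case False
    \<comment> \<open>Both sides of \<open>two\<close> agree at \<open>t = 0\<close>, so only terms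
      of order one and two in \<open>t\<close> survive; the antisymmetric part of \<open>b\<close>
      is the linear coefficient.\<close>
    have "t * ((v \<bullet> v) * (b w v - b v w))
        \<le> t\<^sup>2 * ((v \<bullet> v) * b w w + (w \<bullet> w) * b v v - 2 * (v \<bullet> w) * b w v)" for t
      using two[of "v + t *\<^sub>R w" v]
      by (simp add: b_simps inner_add_left inner_add_right inner_commute[of w v]
          power2_eq_square algebra_simps)
    then have "(v \<bullet> v) * (b w v - b v w) = 0"
      by (rule zero_if_linear_le_quadratic)
    with False show ?thesis
      by simp
  qed (simp add: b_def)
  have "b (axis i 1) (axis j 1) = G $ i $ j" for i j
    by (simp add: b_def inner_axis' matrix_vector_mult_basis column_def)
  with sym have "transpose G = G"
    by (metis (mono_tags) transpose_def vec_eq_iff vec_lambda_beta)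
  with nonneg show ?thesis
    by (simp add: psd_def b_def)
qed

text \<open>A maximiser \<open>Q\<close> of the inner product with \<open>B\<close> also beats every
  \<open>Q ** R\<close>, so \<open>transpose Q ** B\<close> has its maximal trace at
  \<open>R = mat 1\<close>.\<close>

lemma polar_decomposition:
  fixes B :: "real ^ 'k ^ 'k"
  shows "\<exists>Q \<in> (stiefel :: (real ^ 'k ^ 'k) set). psd (transpose Q ** B)"
proof -
  have "continuous_on stiefel (\<lambda>Q :: real ^ 'k ^ 'k. Q \<bullet> B)"
    by (intro continuous_intros)
  moreover have "(stiefel :: (real ^ 'k ^ 'k) set) \<noteq> {}"
    using orthogonal_matrix_id stiefel_square_iff by blast
  ultimately obtain Q where Q: "Q \<in> stiefel"
    and max: "\<And>R. R \<in> stiefel \<Longrightarrow> R \<bullet> B \<le> Q \<bullet> B"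
    using continuous_attains_sup[OF compact_stiefel] by meson
  have "psd (transpose Q ** B)"
  proof (rule psd_if_trace_maximal)
    fix R :: "real ^ 'k ^ 'k"
    assume "R \<in> stiefel"
    with max[of "Q ** R"] Q show "R \<bullet> (transpose Q ** B) \<le> mat 1 \<bullet> (transpose Q ** B)"
      by (simp add: stiefel_mult flip: inner_matrix_mult_left)
  qed
  with Q show ?thesis ..
qed

subsection \<open>Spectral decomposition\<close>

definition diag :: "('k \<Rightarrow> real) \<Rightarrow> real ^ 'k ^ 'k" where
  "diag d = (\<chi> i j. if i = j then d i else 0)"

lemma mult_diag: "(A ** diag d) $ i $ j = A $ i $ j * d j"
  by (simp add: diag_def matrix_matrix_mult_def if_distrib cong: if_cong)

lemma diag_mult: "(diag d ** A) $ i $ j = d i * A $ i $ j"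
  by (simp add: diag_def matrix_matrix_mult_def if_distrib[of "\<lambda>x. x * _"] cong: if_cong)

lemma transpose_diag: "transpose (diag d) = diag d"
  by (auto simp: diag_def transpose_def vec_eq_iff)

lemma trace_diag: "trace (diag d) = sum d UNIV"
  by (simp add: trace_def diag_def)

lemma matrix_pow_diag: "matrix_pow (diag d) m = diag (\<lambda>i. d i ^ m)"
proof (induction m)
  case 0
  then show ?case by (simp add: diag_def mat_def vec_eq_iff)
next
  case (Suc m)
  then show ?case by (simp add: vec_eq_iff diag_mult) (simp add: diag_def)
qed

lemma matrix_pow_conj:
  fixes A U :: "real ^ 'k ^ 'k"
  assumes "U \<in> stiefel"
  shows "matrix_pow (U ** A ** transpose U) m = U ** matrix_pow A m ** transpose U"
proof (induction m)
  case 0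
  then show ?case
    using assms by (simp add: stiefel_square_iff orthogonal_matrix_def)
next
  case (Suc m)
  have "matrix_pow (U ** A ** transpose U) (Suc m)
      = U ** A ** (transpose U ** U) ** matrix_pow A m ** transpose U"
    by (simp add: Suc matrix_mul_assoc)
  with assms show ?case
    by (simp add: stiefel_def matrix_mul_assoc)
qed

lemma trace_conj:
  assumes "U \<in> stiefel"
  shows "trace (U ** A ** transpose U) = trace (A :: real ^ 'k ^ 'k)"
proof -
  have "trace (U ** A ** transpose U) = trace (transpose U ** U ** A)"
    by (simp add: trace_mul_sym[of "U ** A"] matrix_mul_assoc)
  with assms show ?thesis
    by (simp add: stiefel_def)
qed

lemma psd_congruence:
  assumes "psd A"
  shows "psd (transpose U ** A ** U)"
proof -
  have "x \<bullet> ((transpose U ** A ** U) *v x) = (U *v x) \<bullet> (A *v (U *v x))" for x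
    by (metis dot_lmul_matrix inner_commute matrix_vector_mul_assoc transpose_matrix_vector)
  with assms show ?thesis
    by (simp add: psd_def matrix_transpose_mul matrix_mul_assoc)
qed

lemma psd_diagonal_nonneg:
  assumes "psd A"
  shows "0 \<le> A $ i $ i"
proof -
  have "0 \<le> axis i 1 \<bullet> (A *v axis i 1)"
    using assms by (simp add: psd_def)
  then show ?thesis
    by (simp add: inner_axis' matrix_vector_mult_basis column_def)
qed

text \<open>Maximise \<open>tr(U\<^sup>TAUC)\<close> with \<open>C\<close> diagonal with distinct nonnegative entries. This function of \<open>U\<close> is
  convex, so a maximiser also maximises its linearisation, and \<open>U\<^sup>TAUC\<close> is symmetric by
  \<open>psd_if_trace_maximal\<close>. Hence \<open>U\<^sup>TAU\<close> commutes with \<open>C\<close> and is diagonal.\<close>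

theorem spectral_decomposition_psd:
  fixes A :: "real ^ 'k ^ 'k"
  assumes "psd A"
  obtains U :: "real ^ 'k ^ 'k" and a where "U \<in> stiefel" and "\<And>i. 0 \<le> a i" and "A = U ** diag a ** transpose U"
proof -
  have sym: "transpose A = A"
    using assms by (simp add: psd_def)
  \<comment> \<open>An injection into the naturals supplies weights that are both distinct and
    nonnegative.\<close>
  obtain g :: "'k \<Rightarrow> nat" where g: "inj g"
    using finite_imp_inj_to_nat_seg[of "UNIV :: 'k set"] by auto
  define c where "c i = real (g i)" for i
  define L where "L U = A ** U ** diag c" for U :: "real ^ 'k ^ 'k"
  have L_sym: "U \<bullet> L V = V \<bullet> L U" for U V
  proof -
    have "V \<bullet> L U = (A ** U ** diag c) \<bullet> V"
      by (simp add: L_def inner_commute)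
    also have "\<dots> = U \<bullet> (transpose A ** (V ** transpose (diag c)))"
      by (simp only: inner_matrix_mult_right[of "A ** U"] inner_matrix_mult_left[of A U])
    finally show ?thesis
      by (simp add: L_def sym transpose_diag matrix_mul_assoc)
  qed
  \<comment> \<open>The form is a sum of diagonal entries of a congruent psd matrix with weights
    \<open>c i\<close>; this is the convexity of the objective.\<close>
  have L_nonneg: "0 \<le> W \<bullet> L W" for W
  proof -
    have "W \<bullet> L W = (A ** W) \<bullet> (W ** diag c)"
      unfolding L_def by (metis inner_commute inner_matrix_mult_right transpose_diag)
    also have "\<dots> = (transpose W ** A ** W) \<bullet> diag c"
      by (metis inner_commute inner_matrix_mult_left matrix_mul_assoc)
    also have "\<dots> = (\<Sum>i\<in>UNIV. (transpose W ** A ** W) $ i $ i * c i)"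
      by (simp add: inner_vec_def diag_def if_distrib cong: if_cong)
    also have "\<dots> \<ge> 0"
      using psd_diagonal_nonneg[OF psd_congruence[OF assms]]
      by (intro sum_nonneg mult_nonneg_nonneg) (auto simp: c_def)
    finally show ?thesis .
  qed
  have L_diff: "L (V - U) = L V - L U" for U V
    by (simp add: L_def matrix_mult.diff_left matrix_mult.diff_right)
  have "continuous_on stiefel (\<lambda>U. U \<bullet> L U)"
    unfolding L_def by (intro continuous_intros matrix_mult.continuous_on)
  moreover have "(stiefel :: (real ^ 'k ^ 'k) set) \<noteq> {}"
    using orthogonal_matrix_id stiefel_square_iff by blast
  ultimately obtain U where U: "U \<in> stiefel"
    and max: "\<And>V. V \<in> stiefel \<Longrightarrow> V \<bullet> L V \<le> U \<bullet> L U"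
    using continuous_attains_sup[OF compact_stiefel] by meson
  \<comment> \<open>Expanding \<open>(V - U) \<bullet> L (V - U)\<close> bounds twice
    \<open>V \<bullet> L U\<close> by the sum of the objectives at \<open>V\<close> and
    \<open>U\<close>.\<close>
  have lin: "V \<bullet> L U \<le> U \<bullet> L U" if "V \<in> stiefel" for V
    using max[OF that] L_nonneg[of "V - U"] L_sym[of U V]
    by (simp add: L_diff inner_diff_left inner_diff_right)
  define S where "S = transpose U ** A ** U"
  have "psd S"
    unfolding S_def using assms by (rule psd_congruence)
  have "psd (transpose U ** L U)"
  proof (rule psd_if_trace_maximal)
    fix R :: "real ^ 'k ^ 'k"
    assume "R \<in> stiefel"
    with lin[of "U ** R"] U show "R \<bullet> (transpose U ** L U) \<le> mat 1 \<bullet> (transpose U ** L U)"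
      by (simp add: stiefel_mult flip: inner_matrix_mult_left)
  qed
  then have "transpose (S ** diag c) = S ** diag c"
    by (simp add: psd_def S_def L_def matrix_mul_assoc)
  then have "transpose (S ** diag c) $ i $ j = (S ** diag c) $ i $ j" for i j
    by (rule arg_cong)
  then have comm: "S $ j $ i * c i = S $ i $ j * c j" for i j
    by (simp add: transpose_def mult_diag)
  have "transpose S $ i $ j = S $ i $ j" for i j
    using \<open>psd S\<close> by (simp add: psd_def)
  then have S_sym: "S $ j $ i = S $ i $ j" for i j
    by (simp add: transpose_def)
  have "S $ i $ j * c i = S $ i $ j * c j" for i j
    using comm[of i j] S_sym[of j i] by auto
  \<comment> \<open>For \<open>i \<noteq> j\<close> the weights \<open>c i\<close> and
    \<open>c j\<close> differ, so the entry must vanish.\<close>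
  then have "S $ i $ j = 0" if "i \<noteq> j" for i j
    using that g by (auto simp: c_def inj_eq)
  then have S: "S = diag (\<lambda>i. S $ i $ i)"
    by (simp add: vec_eq_iff diag_def)
  have UU: "U ** transpose U = mat 1"
    using U by (simp add: stiefel_square_iff orthogonal_matrix_def)
  have "U ** S ** transpose U = (U ** transpose U) ** A ** (U ** transpose U)"
    by (simp add: S_def matrix_mul_assoc)
  then have "A = U ** S ** transpose U"
    by (simp add: UU)
  with S that[OF U, of "\<lambda>i. S $ i $ i"] psd_diagonal_nonneg[OF \<open>psd S\<close>] show thesis
    by simp
qed

subsection \<open>The trace inequality\<close>

text \<open>The graph of the convex function \<open>x ^ Suc m\<close> lies above its tangent at
  \<open>a\<close>.\<close>

lemma young_power:
  fixes a s :: real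
  assumes "0 \<le> a" and "0 \<le> s"
  shows "real (Suc m) * a ^ m * s \<le> s ^ Suc m + real m * a ^ Suc m"
proof (induction m)
  case (Suc m)
  \<comment> \<open>Both factors have the same sign. Adding this to \<open>a\<close> times the
    induction hypothesis cancels the mixed term \<open>a * s ^ Suc m\<close>.\<close>
  have "0 \<le> (s - a) * (s ^ Suc m - a ^ Suc m)"
    using assms
    by (cases "a \<le> s") (auto intro!: mult_nonneg_nonneg mult_nonpos_nonpos power_mono
        simp del: power_Suc)
  moreover have "a * (real (Suc m) * a ^ m * s) \<le> a * (s ^ Suc m + real m * a ^ Suc m)"
    using Suc assms by (intro mult_left_mono)
  ultimately show ?case
    by (simp add: algebra_simps)
qed simp

text \<open>Meant for \<open>S = transpose (P' ** Q) ** D\<close>, where orthogonality of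
  \<open>Q\<close> turns \<open>Q ** S\<close> into \<open>transpose P' ** D\<close>.\<close>

lemma trace_power_inequality:
  fixes A Q S :: "real ^ 'k ^ 'k"
  assumes "psd A" and "psd S" and Q: "Q \<in> stiefel"
  shows "real (Suc m) * trace (matrix_pow A m ** (Q ** S))
    \<le> trace (matrix_pow S (Suc m)) + real m * trace (matrix_pow A (Suc m))"
proof -
  obtain U :: "real ^ 'k ^ 'k" and a where U: "U \<in> stiefel" and a: "\<And>i. 0 \<le> a i" and A: "A = U ** diag a ** transpose U"
    using spectral_decomposition_psd[OF \<open>psd A\<close>] by metis
  obtain V :: "real ^ 'k ^ 'k" and s where V: "V \<in> stiefel" and s: "\<And>i. 0 \<le> s i" and S: "S = V ** diag s ** transpose V"
    using spectral_decomposition_psd[OF \<open>psd S\<close>] by metis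
  define W where "W = transpose U ** Q ** V"
  define Z where "Z = transpose U ** V"
  define M where "M i j = ((W $ i $ j)\<^sup>2 + (Z $ i $ j)\<^sup>2) / 2" for i j
  have "orthogonal_matrix W" "orthogonal_matrix Z"
    using U V Q by (simp_all add: W_def Z_def stiefel_square_iff orthogonal_matrix_mul)
  moreover have unit: "(\<Sum>j\<in>UNIV. (X $ i $ j)\<^sup>2) = 1" "(\<Sum>j\<in>UNIV. (X $ j $ i)\<^sup>2) = 1"
    if "orthogonal_matrix X" for X :: "real ^ 'k ^ 'k" and i
  proof -
    have "(X ** transpose X) $ i $ i = 1" "(transpose X ** X) $ i $ i = 1"
      using that by (simp_all add: orthogonal_matrix_def mat_def)
    then show "(\<Sum>j\<in>UNIV. (X $ i $ j)\<^sup>2) = 1" "(\<Sum>j\<in>UNIV. (X $ j $ i)\<^sup>2) = 1"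
      by (simp_all add: matrix_matrix_mult_def transpose_def power2_eq_square)
  qed
  ultimately have row: "(\<Sum>j\<in>UNIV. M i j) = 1" and col: "(\<Sum>j\<in>UNIV. M j i) = 1" for i
    by (simp_all add: M_def sum.distrib flip: sum_divide_distrib)
  have M: "W $ i $ j * Z $ i $ j \<le> M i j" for i j
    using sum_squares_bound[of "W $ i $ j" "Z $ i $ j"] by (simp add: M_def)
  have M0: "0 \<le> M i j" for i j
    by (simp add: M_def)
  have trA: "trace (matrix_pow A n) = (\<Sum>i\<in>UNIV. a i ^ n)" for n
    by (simp add: A matrix_pow_conj[OF U] trace_conj[OF U] matrix_pow_diag trace_diag)
  have trS: "trace (matrix_pow S n) = (\<Sum>i\<in>UNIV. s i ^ n)" for n
    by (simp add: S matrix_pow_conj[OF V] trace_conj[OF V] matrix_pow_diag trace_diag)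
  let ?p = "diag (\<lambda>i. a i ^ m)"
  have "trace (matrix_pow A m ** (Q ** S))
      = trace (U ** (?p ** transpose U ** Q ** V ** diag s ** transpose V))"
    by (simp add: A S matrix_pow_conj[OF U] matrix_pow_diag matrix_mul_assoc)
  also have "\<dots> = trace (?p ** transpose U ** Q ** V ** diag s ** transpose V ** U)"
    by (rule trace_mul_sym)
  also have "\<dots> = trace (?p ** W ** diag s ** transpose Z)"
    by (simp add: W_def Z_def matrix_transpose_mul matrix_mul_assoc)
  also have "\<dots> = (\<Sum>i\<in>UNIV. \<Sum>j\<in>UNIV. a i ^ m * s j * (W $ i $ j * Z $ i $ j))"
    by (simp add: trace_def matrix_matrix_mult_def[of "_ ** diag s"] mult_diag diag_mult
        transpose_def mult_ac)
  \<comment> \<open>The weights \<open>a i ^ m * s j\<close> are nonnegative, so the signs of the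
    entries of \<open>W\<close> and \<open>Z\<close> do not matter.\<close>
  also have "\<dots> \<le> (\<Sum>i\<in>UNIV. \<Sum>j\<in>UNIV. a i ^ m * s j * M i j)"
    using a s M by (intro sum_mono mult_left_mono) auto
  finally have "real (Suc m) * trace (matrix_pow A m ** (Q ** S))
      \<le> real (Suc m) * (\<Sum>i\<in>UNIV. \<Sum>j\<in>UNIV. a i ^ m * s j * M i j)"
    by (intro mult_left_mono) auto
  also have "\<dots> = (\<Sum>i\<in>UNIV. \<Sum>j\<in>UNIV. real (Suc m) * a i ^ m * s j * M i j)"
    by (simp add: sum_distrib_left mult.assoc)
  also have "\<dots> \<le> (\<Sum>i\<in>UNIV. \<Sum>j\<in>UNIV. (s j ^ Suc m + real m * a i ^ Suc m) * M i j)"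
    using a s M0 by (intro sum_mono mult_right_mono young_power)
  also have "\<dots> = (\<Sum>i\<in>UNIV. \<Sum>j\<in>UNIV. s j ^ Suc m * M i j)
      + (\<Sum>i\<in>UNIV. \<Sum>j\<in>UNIV. real m * a i ^ Suc m * M i j)"
    by (simp add: distrib_right sum.distrib)
  \<comment> \<open>Column sums of \<open>M\<close> remove it from the \<open>s\<close> part, row
    sums from the \<open>a\<close> part.\<close>
  also have "(\<Sum>i\<in>UNIV. \<Sum>j\<in>UNIV. s j ^ Suc m * M i j) = (\<Sum>j\<in>UNIV. s j ^ Suc m)"
    by (subst sum.swap) (simp add: col flip: sum_distrib_left)
  also have "(\<Sum>i\<in>UNIV. \<Sum>j\<in>UNIV. real m * a i ^ Suc m * M i j) = real m * (\<Sum>i\<in>UNIV. a i ^ Suc m)"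
    by (simp add: row flip: sum_distrib_left)
  finally show ?thesis
    by (simp only: trA trS)
qed

subsection \<open>The gradient\<close>

text \<open>Expanding \<open>H\<close> in matrix units and using linearity of \<open>f'\<close>
  turns every pairing with the entrywise gradient into a directional derivative.\<close>

lemma trace_matrix_grad:
  fixes f :: "real ^ 'k ^ 'n \<Rightarrow> real"
  assumes f: "(f has_derivative f') (at P)"
  shows "trace (transpose H ** matrix_grad f P) = f' H"
proof -
  have lin: "linear f'"
    using f by (rule has_derivative_linear)
  have "deriv (\<lambda>t. f (P + t *\<^sub>R E)) 0 = f' E" for E
  proof (rule DERIV_imp_deriv)
    have "((\<lambda>t. P + t *\<^sub>R E) has_derivative (\<lambda>t. t *\<^sub>R E)) (at 0)"
      by (auto intro!: derivative_eq_intros)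
    moreover have "(f has_derivative f') (at (P + 0 *\<^sub>R E))"
      using f by simp
    ultimately have "((\<lambda>t. f (P + t *\<^sub>R E)) has_derivative (\<lambda>t. f' (t *\<^sub>R E))) (at 0)"
      by (rule has_derivative_compose)
    then show "((\<lambda>t. f (P + t *\<^sub>R E)) has_field_derivative f' E) (at 0)"
      by (simp add: has_field_derivative_def linear_scale[OF lin] mult.commute[of _ "f' E"])
  qed
  then have grad: "matrix_grad f P $ i $ j = f' (axis i (axis j 1))" for i j
    by (simp add: matrix_grad_def)
  have sum_if: "(\<Sum>j\<in>UNIV. if b then g j else 0) = (if b then sum g UNIV else 0)"
    for b and g :: "'k \<Rightarrow> real"
    by simp
  have "H = (\<Sum>i\<in>UNIV. \<Sum>j\<in>UNIV. H $ i $ j *\<^sub>R axis i (axis j 1))"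
    by (simp add: vec_eq_iff axis_def if_distrib[of "\<lambda>x. x $ _"] if_distrib[of "\<lambda>x. _ * x"]
        sum_if cong: if_cong)
  then have "f' H = f' (\<Sum>i\<in>UNIV. \<Sum>j\<in>UNIV. H $ i $ j *\<^sub>R axis i (axis j 1))"
    by (rule arg_cong)
  also have "\<dots> = (\<Sum>i\<in>UNIV. \<Sum>j\<in>UNIV. H $ i $ j * f' (axis i (axis j 1)))"
    by (simp add: linear_sum[OF lin] linear_scale[OF lin])
  finally show ?thesis
    by (simp add: trace_transpose_mult inner_vec_def grad)
qed

lemma has_derivative_transpose_mult:
  fixes D :: "real ^ 'k ^ 'n"
  shows "((\<lambda>X. transpose X ** D) has_derivative (\<lambda>H. transpose H ** D)) (at P)"
  by (intro bounded_linear_imp_has_derivative bounded_linear_compose[OF _ bounded_linear_transpose]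
      matrix_mult.bounded_linear_left)

text \<open>\<open>L\<close> itself is a sum of \<open>m + 1\<close> terms, since \<open>H\<^sup>TD\<close> need not commute with \<open>A\<close>; testing it against the
  commutant of \<open>A\<close> is stable under the induction.\<close>

lemma matrix_pow_has_derivative:
  fixes D P :: "real ^ 'k ^ 'n"
  defines "A \<equiv> transpose P ** D"
  shows "\<exists>L. ((\<lambda>X. matrix_pow (transpose X ** D) (Suc m)) has_derivative L) (at P) \<and>
    (\<forall>N H. N ** A = A ** N \<longrightarrow>
      trace (N ** L H) = real (Suc m) * trace (N ** matrix_pow A m ** (transpose H ** D)))"
proof (induction m)
  case 0
  show ?case
    using has_derivative_transpose_mult[of D P]
    by (intro exI[of _ "\<lambda>H. transpose H ** D"]) simp
next
  case (Suc m)
  then obtain L where L: "((\<lambda>X. matrix_pow (transpose X ** D) (Suc m)) has_derivative L) (at P)"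
    and tr: "\<And>N H. N ** A = A ** N \<Longrightarrow>
      trace (N ** L H) = real (Suc m) * trace (N ** matrix_pow A m ** (transpose H ** D))"
    by blast
  let ?L = "\<lambda>H. A ** L H + (transpose H ** D) ** matrix_pow A (Suc m)"
  have "((\<lambda>X. matrix_pow (transpose X ** D) (Suc (Suc m))) has_derivative ?L) (at P)"
    unfolding matrix_pow.simps(2)[of _ "Suc m"] A_def
    by (rule matrix_mult.FDERIV[OF has_derivative_transpose_mult L])
  moreover have "trace (N ** ?L H)
      = real (Suc (Suc m)) * trace (N ** matrix_pow A (Suc m) ** (transpose H ** D))"
    if N: "N ** A = A ** N" for N H
  proof -
    have pow: "matrix_pow A n ** N = N ** matrix_pow A n" for n
      by (induction n) (simp_all flip: matrix_mul_assoc, simp add: matrix_mul_assoc N)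
    have "trace (N ** A ** L H)
        = real (Suc m) * trace (N ** matrix_pow A (Suc m) ** (transpose H ** D))"
    proof -
      \<comment> \<open>The induction hypothesis is used for \<open>N ** A\<close>, which again
        commutes with \<open>A\<close>; this is why \<open>N\<close> is kept general.\<close>
      have "N ** A ** A = A ** (N ** A)"
        by (metis N matrix_mul_assoc)
      from tr[OF this] show ?thesis
        by (simp add: matrix_mul_assoc)
    qed
    \<comment> \<open>Cyclicity moves the power to the front, where it commutes with
      \<open>N\<close>.\<close>
    moreover have "trace (N ** (transpose H ** D) ** matrix_pow A (Suc m))
        = trace (N ** matrix_pow A (Suc m) ** (transpose H ** D))"
      unfolding trace_mul_sym[of "N ** (transpose H ** D)"]
      by (simp only: matrix_mul_assoc pow)
    ultimately show ?thesis
      by (simp add: matrix_mult.add_right trace_add matrix_mul_assoc algebra_simps)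
  qed
  ultimately show ?case
    by blast
qed

text \<open>The identity commutes with everything, so \<open>N = mat 1\<close> gives the trace
  itself.\<close>

lemma trace_matrix_pow_has_derivative:
  fixes D P :: "real ^ 'k ^ 'n"
  shows "((\<lambda>X. trace (matrix_pow (transpose X ** D) (Suc m))) has_derivative
    (\<lambda>H. real (Suc m) * trace (matrix_pow (transpose P ** D) m ** (transpose H ** D)))) (at P)"
proof -
  obtain L where L: "((\<lambda>X. matrix_pow (transpose X ** D) (Suc m)) has_derivative L) (at P)"
    and tr: "\<And>N H. N ** (transpose P ** D) = (transpose P ** D) ** N \<Longrightarrow>
      trace (N ** L H) =
        real (Suc m) * trace (N ** matrix_pow (transpose P ** D) m ** (transpose H ** D))"
    using matrix_pow_has_derivative[of D m P] by blast
  from bounded_linear.has_derivative[OF bounded_linear_trace L] tr[of "mat 1"] show ?thesis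
    by simp
qed

lemma matrix_pow_comm: "matrix_pow A m ** A = A ** matrix_pow A m"
  by (induction m) (simp_all flip: matrix_mul_assoc)

(* The conjuncts are, in order: (a); (b)(i); (b)(ii); atomicity with alpha = 1, beta = m - 1 on
   the D-plus part of the Stiefel manifold; and, for the first power, atomicity on the whole
   Stiefel manifold, where Q = I is admissible and gives equality in condition (2). *)
theorem theorem4p3:
  fixes D :: "real ^ 'k ^ 'n" and m :: nat
  assumes "CARD('k) \<le> CARD('n)" and "1 \<le> m"
  shows "
    (\<forall>P :: real ^ 'k ^ 'n.
        (\<lambda>X. trace (matrix_pow (transpose X ** D) m)) differentiable (at P) \<and>
        trace (transpose P ** matrix_grad (\<lambda>X. trace (matrix_pow (transpose X ** D) m)) P)
          = real m * trace (matrix_pow (transpose P ** D) m)) \<and>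
    (\<forall>P P' :: real ^ 'k ^ 'n.
        trace (transpose P' ** matrix_grad (\<lambda>X. trace (transpose X ** D)) P)
          = trace (transpose P' ** D)) \<and>
    (\<forall>P P' :: real ^ 'k ^ 'n. psd (transpose P ** D) \<longrightarrow>
        (\<exists>Q \<in> (stiefel :: (real ^ 'k ^ 'k) set). psd (transpose (P' ** Q) ** D)) \<and>
        (\<forall>Q \<in> (stiefel :: (real ^ 'k ^ 'k) set). psd (transpose (P' ** Q) ** D) \<longrightarrow>
          trace (transpose P' ** matrix_grad (\<lambda>X. trace (matrix_pow (transpose X ** D) m)) P)
            \<le> trace (matrix_pow (transpose (P' ** Q) ** D) m)
              + (real m - 1) * trace (matrix_pow (transpose P ** D) m))) \<and>
    atomic_NPDo_with (\<lambda>X. trace (matrix_pow (transpose X ** D) m))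
      (stiefel_Dplus D) 1 (real m - 1) \<and>
    atomic_NPDo (\<lambda>X. trace (matrix_pow (transpose X ** D) m)) \<and>
    atomic_NPDo_with (\<lambda>X. trace (transpose X ** D)) stiefel 1 0 \<and>
    (mat 1 :: real ^ 'k ^ 'k) \<in> stiefel \<and>
    (\<forall>P \<in> stiefel. \<forall>P' \<in> stiefel.
        P' ** (mat 1 :: real ^ 'k ^ 'k) = P' \<and>
        P' ** (mat 1 :: real ^ 'k ^ 'k) \<in> stiefel \<and>
        trace (transpose P' ** matrix_grad (\<lambda>X. trace (transpose X ** D)) P)
          = 1 * trace (transpose (P' ** (mat 1 :: real ^ 'k ^ 'k)) ** D)
            + 0 * trace (transpose P ** D)) \<and>
    atomic_NPDo (\<lambda>X. trace (transpose X ** D))"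
proof -
  obtain l where m: "m = Suc l"
    using \<open>1 \<le> m\<close> by (cases m) auto
  let ?f = "\<lambda>X. trace (matrix_pow (transpose X ** D) m)"
  let ?h = "\<lambda>X. trace (transpose X ** D)"
  have der: "(?f has_derivative
      (\<lambda>H. real m * trace (matrix_pow (transpose P ** D) l ** (transpose H ** D)))) (at P)" for P
    unfolding m by (rule trace_matrix_pow_has_derivative)
  have diff: "?f differentiable (at P)" for P
    using der differentiable_def by blast
  have grad: "trace (transpose H ** matrix_grad ?f P)
      = real m * trace (matrix_pow (transpose P ** D) l ** (transpose H ** D))" for P H
    by (rule trace_matrix_grad[OF der])
  \<comment> \<open>Euler's identity for a function homogeneous of degree \<open>m\<close>, read off
    from the direction \<open>H = P\<close>.\<close>
  have a: "trace (transpose P ** matrix_grad ?f P) = real m * ?f P" for P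
    unfolding grad by (simp add: m matrix_pow_comm)
  have derh: "(?h has_derivative (\<lambda>H. trace (transpose H ** D))) (at P)" for P
    by (rule bounded_linear.has_derivative[OF bounded_linear_trace has_derivative_transpose_mult])
  have diffh: "?h differentiable (at P)" for P
    using derh differentiable_def by blast
  have gradh: "trace (transpose H ** matrix_grad ?h P) = trace (transpose H ** D)" for P H
    by (rule trace_matrix_grad[OF derh])
  \<comment> \<open>The polar factor of \<open>transpose P' ** D\<close> serves as \<open>Q\<close>,
    for arbitrary \<open>P'\<close>.\<close>
  have ex: "\<exists>Q \<in> (stiefel :: (real ^ 'k ^ 'k) set). psd (transpose (P' ** Q) ** D)"
    for P' :: "real ^ 'k ^ 'n"
    using polar_decomposition[of "transpose P' ** D"]
    by (simp add: matrix_transpose_mul matrix_mul_assoc)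
  have ineq: "trace (transpose P' ** matrix_grad ?f P) \<le> ?f (P' ** Q) + (real m - 1) * ?f P"
    if "psd (transpose P ** D)" and Q: "Q \<in> stiefel" and "psd (transpose (P' ** Q) ** D)"
    for P P' :: "real ^ 'k ^ 'n" and Q :: "real ^ 'k ^ 'k"
  proof -
    \<comment> \<open>Replacing \<open>transpose P' ** D\<close> by \<open>Q ** S\<close> brings the
      gradient pairing into the form of \<open>trace_power_inequality\<close>.\<close>
    have "Q ** (transpose (P' ** Q) ** D) = (Q ** transpose Q) ** (transpose P' ** D)"
      by (simp add: matrix_transpose_mul matrix_mul_assoc)
    also have "\<dots> = transpose P' ** D"
      using Q by (simp add: stiefel_square_iff orthogonal_matrix_def)
    finally show ?thesis
      using trace_power_inequality[OF that(1) that(3) Q, of l]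
      unfolding grad by (simp add: m)
  qed
  have I: "(mat 1 :: real ^ 'k ^ 'k) \<in> stiefel"
    by (simp add: stiefel_def)
  have atomic: "atomic_NPDo_with ?f (stiefel_Dplus D) 1 (real m - 1)"
    unfolding atomic_NPDo_with_def
  proof (intro conjI)
    show "differentiable_near_stiefel ?f"
      unfolding differentiable_near_stiefel_def using diff by (metis zero_less_one)
    show "atomic_cond1 ?f (stiefel_Dplus D) (1 + (real m - 1))"
      by (simp add: atomic_cond1_def a)
    show "atomic_cond2 ?f (stiefel_Dplus D) 1 (real m - 1)"
      unfolding atomic_cond2_def
    proof (intro ballI)
      fix P P' :: "real ^ 'k ^ 'n"
      assume P: "P \<in> stiefel_Dplus D" and P': "P' \<in> stiefel"
      obtain Q :: "real ^ 'k ^ 'k" where Q: "Q \<in> stiefel" "psd (transpose (P' ** Q) ** D)"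
        using ex by blast
      with P P' ineq[of P Q P'] show "\<exists>Q \<in> (stiefel :: (real ^ 'k ^ 'k) set).
          P' ** Q \<in> stiefel_Dplus D \<and>
          trace (transpose P' ** matrix_grad ?f P) \<le> 1 * ?f (P' ** Q) + (real m - 1) * ?f P"
        by (auto simp: stiefel_Dplus_def stiefel_mult)
    qed
  qed (use \<open>1 \<le> m\<close> in \<open>auto simp: stiefel_Dplus_def\<close>)
  have atomich: "atomic_NPDo_with ?h stiefel 1 0"
    unfolding atomic_NPDo_with_def
  proof (intro conjI)
    show "differentiable_near_stiefel ?h"
      unfolding differentiable_near_stiefel_def using diffh by (metis zero_less_one)
    show "atomic_cond1 ?h stiefel (1 + 0)"
      by (simp add: atomic_cond1_def gradh)
    show "atomic_cond2 ?h stiefel 1 0"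
      unfolding atomic_cond2_def
      \<comment> \<open>The witness is \<open>Q = mat 1\<close>; the pairing does not depend on
        \<open>P\<close>, so the bound is attained.\<close>
      by (intro ballI bexI[OF _ I]) (simp add: gradh)
  qed auto
  have "atomic_NPDo ?f" "atomic_NPDo ?h"
    using atomic atomich unfolding atomic_NPDo_def by blast+
  with diff a gradh ex ineq I atomic atomich show ?thesis
    by simp
qed

end
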